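(* Let $a,b,c,\alpha,\beta,\gamma$ be integers with $0\le\alpha<a$, $0\le\beta<b$, $0\le\gamma<c$ and at most one of $\alpha,\beta,\gamma$ zero. Suppose $a+b+c+\alpha+\beta+\gamma\equiv 0\pmod 3$, put $s=\frac13(a+b+c+\alpha+\beta+\gamma)-2$, $A=s+2-a$, $B=s+2-b$, $C=s+2-c$, $M=s+2-(\alpha+\beta+\gamma)$, and assume $0\le M$, $0\le A\le\beta+\gamma$, $0\le B\le\alpha+\gamma$, $0\le C\le\alpha+\beta$. If $M$ is even, then $$\operatorname{perm} Z_{a,b,c,\alpha,\beta,\gamma}=|\det Z_{a,b,c,\alpha,\beta,\gamma}|.$$
   Context: $Z_{a,b,c,\alpha,\beta,\gamma}$ is the integer matrix with rows indexed by the monomials $m_i$ in $x,y,z$ of degree $s$ not in the ideal $I=(x^a,y^b,z^c,x^\alpha y^\beta z^\gamma)$ and columns indexed by the monomials $n_j$ of degree $s+1$ not in $I$ (both in lexicographic order; the numbers of rows and columns agree under the hypotheses), with entry $1$ if $m_i$ divides $n_j$ and $0$ otherwise. $\operatorname{perm}$ denotes the permanent, $\operatorname{perm}Z=\sum_{\pi\in\mathfrak S_n}\prod_{i=1}^n Z_{i,\pi(i)}$ for an $n\times n$ matrix. The hypotheses on the parameters are exactly those under which the paper associates to them a punctured hexagon $H_{a,b,c,\alpha,\beta,\gamma}$, whose puncture has side-length $M$. *)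

theory Defs
  imports
    Jordan_Normal_Form.Determinant
    "HOL-Library.Poly_Mapping"
    "HOL-Library.Product_Plus"
begin

text \<open>
  The polynomial ring \<open>k[x,y,z]\<close>, as the algebra over \<open>k\<close> of the additive monoid of exponent
  vectors \<open>(i,j,l)\<close>; multiplication is convolution, so
  \<open>monomial i j l\<close> is the monomial \<open>x\<^sup>i y\<^sup>j z\<^sup>l\<close>.
\<close>

type_synonym 'k poly3 = "(nat \<times> nat \<times> nat) \<Rightarrow>\<^sub>0 'k"

definition monomial :: "nat \<Rightarrow> nat \<Rightarrow> nat \<Rightarrow> 'k::field poly3" where
  "monomial i j l = Poly_Mapping.single (i, j, l) 1"

text \<open>
  The ideal generated by \<open>G\<close> is the span of \<open>G\<close> in the ring regarded as a module over itself.
\<close>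

definition ideal_gen :: "'r::comm_ring_1 set \<Rightarrow> 'r set" where
  "ideal_gen G = module.span (*) G"

definition ideal_I :: "nat \<Rightarrow> nat \<Rightarrow> nat \<Rightarrow> nat \<Rightarrow> nat \<Rightarrow> nat \<Rightarrow> 'k::field poly3 set" where
  "ideal_I a b c \<alpha> \<beta> \<gamma> =
     ideal_gen {monomial a 0 0, monomial 0 b 0, monomial 0 0 c, monomial \<alpha> \<beta> \<gamma>}"

text \<open>
  All monomials of degree \<open>d\<close> in lexicographic order with \<open>x > y > z\<close>, largest first
  (\<open>x\<^sup>d\<close>, then \<open>x\<^bsup>d-1\<^esup> y\<close>, then \<open>x\<^bsup>d-1\<^esup> z\<close>, down to \<open>z\<^sup>d\<close>).
\<close>

definition monomials_lex :: "nat \<Rightarrow> 'k::field poly3 list" where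
  "monomials_lex d =
     [monomial i j (d - i - j). i \<leftarrow> rev [0..<d + 1], j \<leftarrow> rev [0..<d - i + 1]]"

definition monomials_notin :: "'k::field poly3 set \<Rightarrow> nat \<Rightarrow> 'k poly3 list" where
  "monomials_notin I d = filter (\<lambda>m. m \<notin> I) (monomials_lex d)"

text \<open>
  The matrix \<open>Z\<close>. Its entries do not depend on the coefficient field \<open>k\<close> of the ring in which
  the monomials live, which is an explicit parameter. The subtraction in the definition of \<open>s\<close>
  is on natural numbers; it does not truncate when the sum of the parameters is at least \<open>6\<close>,
  which holds if \<open>\<alpha> < a\<close>, \<open>\<beta> < b\<close>, \<open>\<gamma> < c\<close> and at most one of \<open>\<alpha>, \<beta>, \<gamma>\<close> is zero.
\<close>

definition Z_mat ::
  "'k::field itself \<Rightarrow> nat \<Rightarrow> nat \<Rightarrow> nat \<Rightarrow> nat \<Rightarrow> nat \<Rightarrow> nat \<Rightarrow> int mat" where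
  "Z_mat _ a b c \<alpha> \<beta> \<gamma> =
     (let s = (a + b + c + \<alpha> + \<beta> + \<gamma>) div 3 - 2;
          I = (ideal_I a b c \<alpha> \<beta> \<gamma> :: 'k poly3 set);
          ms = monomials_notin I s;
          ns = monomials_notin I (s + 1)
      in mat (length ms) (length ns) (\<lambda>(i, j). if ms ! i dvd ns ! j then 1 else 0))"

text \<open>As for \<^const>\<open>det\<close>, the value on a non-square matrix is \<open>0\<close> by convention.\<close>

definition perm :: "'r::comm_ring_1 mat \<Rightarrow> 'r" where
  "perm A = (if dim_row A = dim_col A
     then \<Sum>\<pi> | \<pi> permutes {0..<dim_row A}. \<Prod>i = 0..<dim_row A. A $$ (i, \<pi> i)
     else 0)"

end

theory Submission
  imports Defs "HOL-Library.Product_Lexorder"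
begin

text \<open>
  The terms of \<open>perm Z\<close> and \<open>det Z\<close> belong to the bijections \<open>f\<close> from the monomials of degree \<open>s\<close>
  outside \<open>I\<close> to those of degree \<open>s + 1\<close> such that \<open>f m\<close> is \<open>x m\<close>, \<open>y m\<close> or \<open>z m\<close>; they differ
  by the sign of the permutation that \<open>f\<close> induces. So the claim is that all these signs agree
  (\<open>perm_eq_abs_det\<close>), and the sign is the parity of the number of inversions of \<open>f\<close> for the
  lexicographic order (\<open>sign_eq_inversions_of_matching\<close>).

  A monomial of degree \<open>d\<close> is given by its exponents \<open>(i, j)\<close> of \<open>x\<close> and \<open>y\<close>. Call \<open>i\<close> its level.
  If \<open>f\<close> multiplies by \<open>y\<close> or \<open>z\<close> the level stays, and \<open>j\<close> grows by at most \<open>1\<close>; if \<open>f\<close>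
  multiplies by \<open>x\<close> (the monomial is \<^emph>\<open>raised\<close>) the level grows by \<open>1\<close> and \<open>j\<close> stays. Since \<open>f\<close> is
  injective, it preserves the order within the raised monomials and within the others. Hence an
  inversion consists of a raised monomial \<open>u\<close> and one that is not raised, which lies either above
  \<open>u\<close> in the level of \<open>u\<close>, or in the next level with an image below \<open>x u\<close>. Extending the count to
  all pairs of a raised \<open>u\<close> with \<^emph>\<open>any\<close> monomial of the same kind adds each pair of raised
  monomials of equal level exactly twice. So, modulo \<open>2\<close>, the number of inversions is the sum over
  the raised \<open>u\<close> of a weight: the number of rows above \<open>u\<close> in the level of \<open>u\<close>, plus the number of
  columns below \<open>x u\<close> in the level of \<open>x u\<close> (\<open>even_inversions_iff_weight\<close>).

  The number of raised monomials in each level does not depend on \<open>f\<close> (\<open>card_raised_level\<close>). If the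
  rows of level \<open>i\<close> and the columns of level \<open>i + 1\<close> have the same exponents of \<open>y\<close>, the weight of
  \<open>u\<close> is the size of that level minus \<open>1\<close>, the same for all \<open>u\<close> in it. This is the case for every
  level from which some monomial is raised, except that for \<open>i + 1 = \<alpha>\<close> the columns lack the interval
  \<open>{\<beta>..s - i - \<gamma>}\<close>, the first row of the puncture. This interval has exactly \<open>M\<close> elements, all of
  which occur among the rows, because \<open>B \<le> \<alpha> + \<gamma>\<close> and \<open>C \<le> \<alpha> + \<beta>\<close>; so passing it changes the weight
  by \<open>M\<close>, which is even (\<open>even_hole_before\<close>). Thus the parity is the same for every \<open>f\<close>.
\<close>

section \<open>Signs of permutations and inversions\<close>

definition inversions :: "('a::linorder \<Rightarrow> 'b::linorder) \<Rightarrow> 'a set \<Rightarrow> ('a \<times> 'a) set" where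
  "inversions f S = {(i, j). i \<in> S \<and> j \<in> S \<and> i < j \<and> f j < f i}"

lemma finite_inversions [simp]: "finite S \<Longrightarrow> finite (inversions f S)"
  by (rule finite_subset[of _ "S \<times> S"]) (auto simp: inversions_def)

lemma even_card_symdiff:
  assumes "finite A" "finite B"
  shows "even (card ((A - B) \<union> (B - A))) \<longleftrightarrow> even (card A + card B)"
proof -
  have "card ((A - B) \<union> (B - A)) = card (A - B) + card (B - A)"
    by (rule card_Un_disjoint) (use assms in auto)
  moreover have "card A = card (A - B) + card (A \<inter> B)" "card B = card (B - A) + card (A \<inter> B)"
    using assms by (simp_all add: card_Diff_subset_Int Int_commute card_mono)
  ultimately show ?thesis by auto
qed

text \<open>
  A pair of indices is inverted by \<open>q \<circ> p\<close> iff exactly one of two things happens: \<open>p\<close> inverts it,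
  or \<open>q\<close> inverts its image under \<open>p\<close>. Taking images under \<open>p\<close>, followed by sorting, permutes the
  ordered pairs, so the second kind is as numerous as the inversions of \<open>q\<close>.
\<close>

lemma even_inversions_compose:
  fixes p :: "'a::linorder \<Rightarrow> 'a"
  assumes "finite S" and p: "bij_betw p S S" and q: "inj_on q S"
  shows "even (card (inversions (q \<circ> p) S)) \<longleftrightarrow>
    even (card (inversions p S) + card (inversions q S))"
proof -
  define E where "E = {(i, j). i \<in> S \<and> j \<in> S \<and> i < j}"
  define \<phi> where "\<phi> = (\<lambda>(i, j). (min (p i) (p j), max (p i) (p j)))"
  define Q where "Q = {e \<in> E. \<phi> e \<in> inversions q S}"
  have finE: "finite E"
    by (rule finite_subset[of _ "S \<times> S"]) (use assms in \<open>auto simp: E_def\<close>)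
  have pS: "p i \<in> S" if "i \<in> S" for i
    using p that by (rule bij_betw_apply)
  have p_eq: "p i = p j \<longleftrightarrow> i = j" if "i \<in> S" "j \<in> S" for i j
    using p that by (meson bij_betw_def inj_on_eq_iff)
  have q_eq: "q i = q j \<longleftrightarrow> i = j" if "i \<in> S" "j \<in> S" for i j
    using q that by (meson inj_on_eq_iff)
  have "inj_on \<phi> E"
    by (rule inj_onI) (auto simp: E_def \<phi>_def min_def max_def p_eq split: if_splits)
  moreover have "\<phi> ` E \<subseteq> E"
  proof (intro image_subsetI, clarify)
    fix i j assume "(i, j) \<in> E"
    then have "p i \<in> S" "p j \<in> S" "p i \<noteq> p j"
      by (auto simp: E_def pS p_eq)
    then show "\<phi> (i, j) \<in> E"
      by (cases "p i < p j") (auto simp: E_def \<phi>_def min_def max_def)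
  qed
  ultimately have "\<phi> ` E = E"
    using finE by (metis endo_inj_surj)
  moreover have "inversions q S \<subseteq> E"
    by (auto simp: inversions_def E_def)
  moreover have "\<phi> ` Q = \<phi> ` E \<inter> inversions q S"
    by (auto simp: Q_def)
  ultimately have "\<phi> ` Q = inversions q S"
    by (metis Int_absorb1)
  with \<open>inj_on \<phi> E\<close> have card_Q: "card Q = card (inversions q S)"
    by (metis (no_types, lifting) Q_def card_image inj_on_subset mem_Collect_eq subsetI)
  have "inversions (q \<circ> p) S = (inversions p S - Q) \<union> (Q - inversions p S)"
    (is "?L = ?R")
  proof (rule Set.set_eqI)
    fix e :: "'a \<times> 'a"
    obtain i j where e: "e = (i, j)" by (cases e)
    show "e \<in> ?L \<longleftrightarrow> e \<in> ?R"
    proof (cases "i \<in> S \<and> j \<in> S \<and> i < j")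
      case True
      then have "p i \<in> S" "p j \<in> S" "p i \<noteq> p j" "q (p i) \<noteq> q (p j)"
        by (auto simp: pS p_eq q_eq)
      with True show ?thesis
        by (auto simp: e inversions_def Q_def E_def \<phi>_def min_def max_def)
    qed (auto simp: e inversions_def Q_def E_def)
  qed
  moreover have "finite Q" using finE by (simp add: Q_def)
  ultimately show ?thesis
    using even_card_symdiff[of "inversions p S" Q] \<open>finite S\<close> card_Q by simp
qed

text \<open>
  Besides \<open>(a, b)\<close> itself, the inverted pairs are \<open>(a, k)\<close> and \<open>(k, b)\<close> for each \<open>k\<close> strictly
  between \<open>a\<close> and \<open>b\<close>.
\<close>

lemma odd_inversions_transpose:
  fixes a b :: "'a::linorder"
  assumes "finite S" "a \<in> S" "b \<in> S" "a < b"
  shows "odd (card (inversions (Transposition.transpose a b) S))"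
proof -
  define K where "K = {k \<in> S. a < k \<and> k < b}"
  have finK: "finite K" using assms by (simp add: K_def)
  have "inversions (Transposition.transpose a b) S =
      insert (a, b) (Pair a ` K \<union> (\<lambda>k. (k, b)) ` K)"
    using assms by (auto simp: inversions_def K_def Transposition.transpose_def split: if_splits)
  moreover have "card (Pair a ` K \<union> (\<lambda>k. (k, b)) ` K) = card K + card K"
    using finK by (subst card_Un_disjoint) (auto simp: card_image inj_on_def K_def)
  moreover have "(a, b) \<notin> Pair a ` K \<union> (\<lambda>k. (k, b)) ` K"
    by (auto simp: K_def)
  ultimately show ?thesis using finK by simp
qed

lemma sign_eq_inversions:
  fixes p :: "'a::linorder \<Rightarrow> 'a"
  assumes p: "p permutes S" and S: "finite S"
  shows "sign p = (-1) ^ card (inversions p S)"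
  using p S
proof (induction rule: permutes_induct)
  case id
  have "inversions id S = {}" by (auto simp: inversions_def)
  then show ?case by (simp only: sign_id card.empty power_0)
next
  case (swap a b p)
  have "odd (card (inversions (Transposition.transpose a b) S))"
    using odd_inversions_transpose[OF S, of a b] odd_inversions_transpose[OF S, of b a] swap.hyps
    by (metis neqE transpose_commute)
  moreover have "sign (Transposition.transpose a b \<circ> p) = - sign p"
    using swap.hyps S by (subst sign_compose)
      (auto simp: sign_swap_id permutation_swap_id intro: permutes_imp_permutation)
  ultimately show ?case
    using even_inversions_compose[OF S permutes_imp_bij[OF swap.hyps(4)] inj_on_transpose, of a b]
      swap.IH
    by (simp add: minus_one_power_iff del: o_apply)
qed

text \<open>
  The permutation of positions and the map of the entries themselves have the same number of
  inversions. Both lists are decreasing, which reverses the order of positions on both sides, so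
  that a pair of positions corresponds to the swapped pair of entries.
\<close>

lemma sign_eq_inversions_of_matching:
  fixes rs :: "'a::linorder list" and cs :: "'b::linorder list"
  assumes rs: "sorted_wrt (>) rs" and cs: "sorted_wrt (>) cs"
    and len: "length rs = n" "length cs = n"
    and \<pi>: "\<pi> permutes {0..<n}"
    and f: "\<And>k. k < n \<Longrightarrow> f (rs ! k) = cs ! \<pi> k"
  shows "sign \<pi> = (-1) ^ card (inversions f (set rs))"
proof -
  have less_iff: "xs ! k < xs ! l \<longleftrightarrow> l < k" if "sorted_wrt (>) xs" "k < length xs" "l < length xs"
    for k l and xs :: "'c::linorder list"
    using that sorted_wrt_nth_less[OF that(1), of k l] sorted_wrt_nth_less[OF that(1), of l k]
    by (metis linorder_neqE_nat order_less_asym order_less_irrefl)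
  have rs_less: "rs ! k < rs ! l \<longleftrightarrow> l < k" if "k < n" "l < n" for k l
    using less_iff[OF rs] that len by blast
  have rs_eq: "rs ! k = rs ! l \<longleftrightarrow> k = l" if "k < n" "l < n" for k l
    using rs_less that by (metis linorder_neqE_nat order_less_irrefl)
  have cs_less: "f (rs ! k) < f (rs ! l) \<longleftrightarrow> \<pi> l < \<pi> k" if "k < n" "l < n" for k l
    using that permutes_in_image[OF \<pi>] f less_iff[OF cs, of "\<pi> k" "\<pi> l"] len by simp
  have set_rs: "set rs = (!) rs ` {0..<n}"
    using len by (auto simp: set_conv_nth)
  have "inversions f (set rs) = (\<lambda>(k, l). (rs ! l, rs ! k)) ` inversions \<pi> {0..<n}"
  proof (intro equalityI subsetI)
    fix e assume "e \<in> inversions f (set rs)"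
    then obtain k l where "k < n" "l < n" "e = (rs ! l, rs ! k)" "rs ! l < rs ! k"
        "f (rs ! k) < f (rs ! l)"
      unfolding inversions_def set_rs by fastforce
    then have "(k, l) \<in> inversions \<pi> {0..<n}"
      by (simp add: inversions_def rs_less cs_less)
    with \<open>e = _\<close> show "e \<in> (\<lambda>(k, l). (rs ! l, rs ! k)) ` inversions \<pi> {0..<n}" by force
  next
    fix e assume "e \<in> (\<lambda>(k, l). (rs ! l, rs ! k)) ` inversions \<pi> {0..<n}"
    then obtain k l where "k < n" "l < n" "e = (rs ! l, rs ! k)" "k < l" "\<pi> l < \<pi> k"
      by (auto simp: inversions_def)
    then show "e \<in> inversions f (set rs)"
      by (simp add: inversions_def set_rs rs_less cs_less)
  qed
  moreover have "inj_on (\<lambda>(k, l). (rs ! l, rs ! k)) (inversions \<pi> {0..<n})"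
    by (auto simp: inj_on_def inversions_def rs_eq)
  ultimately show ?thesis
    using sign_eq_inversions[OF \<pi>] by (simp add: card_image)
qed

section \<open>Inversions of a matching that moves by at most one level\<close>

text \<open>
  With \<open>(i, j)\<close> standing for the monomial of degree \<open>d\<close> with exponents \<open>i\<close>, \<open>j\<close> of \<open>x\<close>, \<open>y\<close>, the
  three elements are the products with \<open>x\<close>, \<open>y\<close> and \<open>z\<close>, as monomials of degree \<open>d + 1\<close>.
\<close>

definition successors :: "nat \<times> nat \<Rightarrow> (nat \<times> nat) set" where
  "successors = (\<lambda>(i, j). {(i + 1, j), (i, j + 1), (i, j)})"

locale step_matching =
  fixes R C :: "(nat \<times> nat) set" and f :: "nat \<times> nat \<Rightarrow> nat \<times> nat"
  assumes finite_R: "finite R"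
    and bij: "bij_betw f R C"
    and successor: "r \<in> R \<Longrightarrow> f r \<in> successors r"
begin

lemma step: "(i, j) \<in> R \<Longrightarrow> f (i, j) \<in> {(i + 1, j), (i, j + 1), (i, j)}"
  using successor[of "(i, j)"] by (simp add: successors_def)

definition raised :: "(nat \<times> nat) set" where
  "raised = {r \<in> R. fst (f r) = fst r + 1}"

lemma finite_raised: "finite raised"
  using finite_R by (simp add: raised_def)

lemma f_raised: "(i, j) \<in> raised \<Longrightarrow> f (i, j) = (i + 1, j)"
  using step[of i j] by (auto simp: raised_def)

lemma f_not_raised: "(i, j) \<in> R \<Longrightarrow> (i, j) \<notin> raised \<Longrightarrow> f (i, j) \<in> {(i, j + 1), (i, j)}"
  using step[of i j] by (auto simp: raised_def)

text \<open>
  Two raised elements keep their order, since both move by \<open>(1, 0)\<close>. So do two elements that are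
  not raised: within a level their second coordinates differ by at least \<open>1\<close> and grow by at most
  \<open>1\<close>, and the images are distinct. A raised element can overtake only elements of its own level,
  where it overtakes everything above it, and of the next one.
\<close>

lemma inversions_eq:
  "inversions f R =
     {(u, d). u \<in> raised \<and> d \<in> R - raised \<and> fst d = fst u \<and> snd u < snd d} \<union>
     {(u, d). u \<in> raised \<and> d \<in> R - raised \<and> fst d = fst u + 1 \<and> f d < f u}"
  (is "_ = ?I1 \<union> ?I2")
proof (intro equalityI subsetI)
  fix e assume "e \<in> inversions f R"
  then obtain i j i' j' where e: "e = ((i, j), (i', j'))" "(i, j) \<in> R" "(i', j') \<in> R"
      "(i, j) < (i', j')" "f (i', j') < f (i, j)"
    by (auto simp: inversions_def)
  have "f (i, j) \<noteq> f (i', j')" using e by auto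
  have "(i, j) \<in> raised"
  proof (rule ccontr)
    assume "(i, j) \<notin> raised"
    then show False
      using e f_not_raised[of i j] step[of i' j'] by auto
  qed
  moreover have "(i', j') \<notin> raised"
  proof
    assume "(i', j') \<in> raised"
    then show False
      using e f_raised[of i' j'] step[of i j] by auto
  qed
  ultimately show "e \<in> ?I1 \<union> ?I2"
    using e f_raised[of i j] f_not_raised[of i' j'] by auto
next
  fix e assume "e \<in> ?I1 \<union> ?I2"
  then obtain i j i' j' where e: "e = ((i, j), (i', j'))" "(i, j) \<in> raised" "(i', j') \<in> R - raised"
      "i' = i \<and> j < j' \<or> i' = i + 1 \<and> f (i', j') < f (i, j)"
    by auto
  then show "e \<in> inversions f R"
    using f_raised[of i j] f_not_raised[of i' j'] by (auto simp: inversions_def raised_def)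
qed

definition weight :: "nat \<times> nat \<Rightarrow> nat" where
  "weight r = card {k. (fst r, k) \<in> R \<and> snd r < k} + card {k. (fst r + 1, k) \<in> C \<and> k < snd r}"

text \<open>
  Let \<open>I1\<close> and \<open>I2\<close> be the two kinds of inversions. Allowing raised elements as second components
  adds to \<open>I1\<close> the set \<open>P1\<close> of the increasing pairs of raised elements of equal level, and to \<open>I2\<close>
  the set \<open>P2\<close> of the decreasing ones. These have equal size, so they cancel modulo \<open>2\<close>, and the
  enlarged sets are counted by the two terms of the weight.
\<close>

lemma even_inversions_iff_weight:
  "even (card (inversions f R)) \<longleftrightarrow> even (\<Sum>u\<in>raised. weight u)"
proof -
  define I1 where "I1 = {(u, d). u \<in> raised \<and> d \<in> R - raised \<and> fst d = fst u \<and> snd u < snd d}"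
  define I2 where "I2 = {(u, d). u \<in> raised \<and> d \<in> R - raised \<and> fst d = fst u + 1 \<and> f d < f u}"
  define P1 where "P1 = {(u, v). u \<in> raised \<and> v \<in> raised \<and> fst v = fst u \<and> snd u < snd v}"
  define P2 where "P2 = {(u, v). u \<in> raised \<and> v \<in> raised \<and> fst v = fst u \<and> snd v < snd u}"
  have "I1 \<subseteq> R \<times> R" "I2 \<subseteq> R \<times> R" "P1 \<subseteq> R \<times> R" "P2 \<subseteq> R \<times> R"
    by (auto simp: I1_def I2_def P1_def P2_def raised_def)
  then have fin: "finite I1" "finite I2" "finite P1" "finite P2"
    using finite_R by (meson finite_SigmaI finite_subset)+
  have "P2 = prod.swap ` P1"
    by (auto simp: P1_def P2_def image_iff)
  then have P: "card P2 = card P1"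
    by (metis card_image inj_swap inj_on_subset subset_UNIV)
  have "I1 \<union> P1 = (SIGMA u:raised. {r \<in> R. fst r = fst u \<and> snd u < snd r})"
    by (auto simp: I1_def P1_def raised_def)
  then have "card (I1 \<union> P1) = (\<Sum>u\<in>raised. card {r \<in> R. fst r = fst u \<and> snd u < snd r})"
    using finite_raised finite_R by simp
  also have "\<dots> = (\<Sum>u\<in>raised. card {k. (fst u, k) \<in> R \<and> snd u < k})"
  proof (rule sum.cong[OF refl])
    fix u
    have "{r \<in> R. fst r = fst u \<and> snd u < snd r} = Pair (fst u) ` {k. (fst u, k) \<in> R \<and> snd u < k}"
      by (auto simp: image_iff)
    then show "card {r \<in> R. fst r = fst u \<and> snd u < snd r} = card {k. (fst u, k) \<in> R \<and> snd u < k}"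
      by (simp add: card_image inj_on_def)
  qed
  finally have 1: "card I1 + card P1 = (\<Sum>u\<in>raised. card {k. (fst u, k) \<in> R \<and> snd u < k})"
    using fin by (subst (asm) card_Un_disjoint) (auto simp: I1_def P1_def)
  have "I2 \<union> P2 = (SIGMA u:raised. {r \<in> R. fst (f r) = fst u + 1 \<and> f r < f u})" (is "_ = ?S")
  proof (intro equalityI subsetI)
    fix e assume "e \<in> I2 \<union> P2"
    then obtain i j i' j' where e: "e = ((i, j), (i', j'))" "(i, j) \<in> raised" "(i', j') \<in> R"
      "(i', j') \<notin> raised \<and> i' = i + 1 \<and> f (i', j') < f (i, j) \<or> (i', j') \<in> raised \<and> i' = i \<and> j' < j"
      by (auto simp: I2_def P2_def raised_def)
    then show "e \<in> ?S"
      using f_raised[of i j] f_raised[of i' j'] f_not_raised[of i' j'] by auto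
  next
    fix e assume "e \<in> ?S"
    then obtain i j i' j' where e: "e = ((i, j), (i', j'))" "(i, j) \<in> raised" "(i', j') \<in> R"
      "fst (f (i', j')) = i + 1" "f (i', j') < f (i, j)"
      by auto
    then show "e \<in> I2 \<union> P2"
      using f_raised[of i j] f_raised[of i' j'] f_not_raised[of i' j']
      by (cases "(i', j') \<in> raised") (auto simp: I2_def P2_def)
  qed
  then have "card (I2 \<union> P2) = (\<Sum>u\<in>raised. card {r \<in> R. fst (f r) = fst u + 1 \<and> f r < f u})"
    using finite_raised finite_R by simp
  also have "\<dots> = (\<Sum>u\<in>raised. card {k. (fst u + 1, k) \<in> C \<and> k < snd u})"
  proof (rule sum.cong[OF refl])
    fix u assume u: "u \<in> raised"
    have C: "C = f ` R" using bij by (simp add: bij_betw_def)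
    have fu: "f u = (fst u + 1, snd u)" using f_raised[of "fst u" "snd u"] u by simp
    have "f ` {r \<in> R. fst (f r) = fst u + 1 \<and> f r < f u} = {c \<in> C. fst c = fst u + 1 \<and> c < f u}"
      unfolding C by blast
    also have "\<dots> = Pair (fst u + 1) ` {k. (fst u + 1, k) \<in> C \<and> k < snd u}"
      unfolding fu by auto
    finally have "card (f ` {r \<in> R. fst (f r) = fst u + 1 \<and> f r < f u}) =
        card {k. (fst u + 1, k) \<in> C \<and> k < snd u}"
      by (simp add: card_image inj_on_def)
    moreover have "inj_on f {r \<in> R. fst (f r) = fst u + 1 \<and> f r < f u}"
      using bij by (auto simp: bij_betw_def intro: inj_on_subset)
    ultimately show "card {r \<in> R. fst (f r) = fst u + 1 \<and> f r < f u} =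
        card {k. (fst u + 1, k) \<in> C \<and> k < snd u}"
      by (simp add: card_image)
  qed
  finally have 2: "card I2 + card P2 = (\<Sum>u\<in>raised. card {k. (fst u + 1, k) \<in> C \<and> k < snd u})"
    using fin by (subst (asm) card_Un_disjoint) (auto simp: I2_def P2_def)
  have "card (inversions f R) = card I1 + card I2"
    unfolding inversions_eq I1_def[symmetric] I2_def[symmetric]
    using fin by (subst card_Un_disjoint) (auto simp: I1_def I2_def)
  then have "card (inversions f R) + 2 * card P1 = (\<Sum>u\<in>raised. weight u)"
    using 1 2 P by (simp add: weight_def sum.distrib)
  then show ?thesis by (metis even_add dvd_triv_left)
qed

text \<open>
  The rows of level at most \<open>i\<close> are those mapped to columns of level at most \<open>i\<close>, together with the
  raised rows of level \<open>i\<close>.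
\<close>

lemma card_raised_level:
  "card {u \<in> raised. fst u = i} = card {r \<in> R. fst r \<le> i} - card {c \<in> C. fst c \<le> i}"
proof -
  have C: "C = f ` R" using bij by (simp add: bij_betw_def)
  have "{c \<in> C. fst c \<le> i} = f ` {r \<in> R. fst (f r) \<le> i}"
    unfolding C by auto
  then have "card {c \<in> C. fst c \<le> i} = card {r \<in> R. fst (f r) \<le> i}"
    using bij by (auto simp: bij_betw_def intro!: card_image intro: inj_on_subset)
  moreover have "{r \<in> R. fst r \<le> i} = {u \<in> raised. fst u = i} \<union> {r \<in> R. fst (f r) \<le> i}"
  proof (intro equalityI subsetI)
    fix r assume "r \<in> {r \<in> R. fst r \<le> i}"
    then show "r \<in> {u \<in> raised. fst u = i} \<union> {r \<in> R. fst (f r) \<le> i}"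
      using step[of "fst r" "snd r"] f_raised[of "fst r" "snd r"] f_not_raised[of "fst r" "snd r"]
      by (cases "r \<in> raised") auto
  next
    fix r assume "r \<in> {u \<in> raised. fst u = i} \<union> {r \<in> R. fst (f r) \<le> i}"
    then show "r \<in> {r \<in> R. fst r \<le> i}"
      using step[of "fst r" "snd r"] by (auto simp: raised_def)
  qed
  moreover have "card ({u \<in> raised. fst u = i} \<union> {r \<in> R. fst (f r) \<le> i}) =
      card {u \<in> raised. fst u = i} + card {r \<in> R. fst (f r) \<le> i}"
    using finite_raised finite_R by (intro card_Un_disjoint) (auto simp: raised_def)
  ultimately show ?thesis by simp
qed

text \<open>
  When the parity of the weight depends on the level alone, the right-hand side no longer mentions
  \<open>f\<close>: all matchings of \<open>R\<close> with \<open>C\<close> have the same parity of inversions.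
\<close>

lemma even_inversions_iff_of_weight:
  assumes \<omega>: "\<And>i j. (i, j) \<in> R \<Longrightarrow> (i + 1, j) \<in> C \<Longrightarrow> even (weight (i, j)) \<longleftrightarrow> even (\<omega> i)"
  shows "even (card (inversions f R)) \<longleftrightarrow>
    even (\<Sum>i\<in>fst ` R. (card {r \<in> R. fst r \<le> i} - card {c \<in> C. fst c \<le> i}) * \<omega> i)"
proof -
  have "even (weight u + \<omega> (fst u))" if "u \<in> raised" for u
  proof -
    obtain i j where u: "u = (i, j)" by (cases u)
    have "(i, j) \<in> R" using that by (simp add: raised_def u)
    then have "(i + 1, j) \<in> C"
      using f_raised[of i j] that u bij bij_betw_apply[of f R C] by metis
    then show ?thesis using \<omega>[of i j] \<open>(i, j) \<in> R\<close> u by simp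
  qed
  then have "even (\<Sum>u\<in>raised. weight u + \<omega> (fst u))" by (rule dvd_sum)
  then have "even (\<Sum>u\<in>raised. weight u) \<longleftrightarrow> even (\<Sum>u\<in>raised. \<omega> (fst u))"
    by (simp add: sum.distrib)
  also have "(\<Sum>u\<in>raised. \<omega> (fst u)) = (\<Sum>i\<in>fst ` R. \<Sum>u\<in>{u \<in> raised. fst u = i}. \<omega> (fst u))"
    using finite_raised finite_R by (intro sum.group[symmetric]) (auto simp: raised_def)
  also have "\<dots> = (\<Sum>i\<in>fst ` R. card {u \<in> raised. fst u = i} * \<omega> i)"
    by simp
  finally show ?thesis
    by (simp only: even_inversions_iff_weight card_raised_level)
qed

end

section \<open>Monomials and the ideal\<close>

definition in_I :: "nat \<Rightarrow> nat \<Rightarrow> nat \<Rightarrow> nat \<Rightarrow> nat \<Rightarrow> nat \<Rightarrow> nat \<times> nat \<times> nat \<Rightarrow> bool" where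
  "in_I a b c \<alpha> \<beta> \<gamma> =
     (\<lambda>(i, j, l). a \<le> i \<or> b \<le> j \<or> c \<le> l \<or> \<alpha> \<le> i \<and> \<beta> \<le> j \<and> \<gamma> \<le> l)"

lemma module_mult: "Modules.module ((*) :: 'r::comm_ring_1 \<Rightarrow> 'r \<Rightarrow> 'r)"
  by standard (simp_all add: algebra_simps)

lemma monomial_mult:
  "monomial i j l * monomial i' j' l' = (monomial (i + i') (j + j') (l + l') :: 'k::field poly3)"
  by (simp add: monomial_def mult_single)

lemma monomial_dvd_iff:
  "(monomial i j l :: 'k::field poly3) dvd monomial i' j' l' \<longleftrightarrow> i \<le> i' \<and> j \<le> j' \<and> l \<le> l'"
proof
  assume "(monomial i j l :: 'k poly3) dvd monomial i' j' l'"
  then obtain p where "monomial i' j' l' = monomial i j l * (p :: 'k poly3)" by (elim dvdE)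
  then have "(i', j', l') \<in> Poly_Mapping.keys (monomial i j l * p)"
    by (metis keys_single monomial_def singletonI zero_neq_one)
  then show "i \<le> i' \<and> j \<le> j' \<and> l \<le> l'"
    using keys_mult[of "monomial i j l" p] by (auto simp: monomial_def)
next
  assume "i \<le> i' \<and> j \<le> j' \<and> l \<le> l'"
  then have "monomial i' j' l' = monomial i j l * (monomial (i' - i) (j' - j) (l' - l) :: 'k poly3)"
    by (simp add: monomial_mult)
  then show "(monomial i j l :: 'k poly3) dvd monomial i' j' l'" ..
qed

text \<open>
  For the direction from left to right: the polynomials all of whose monomials are divisible by a
  generator form a submodule that contains the generators.
\<close>

lemma monomial_in_ideal_I_iff:
  "(monomial i j l :: 'k::field poly3) \<in> ideal_I a b c \<alpha> \<beta> \<gamma> \<longleftrightarrow> in_I a b c \<alpha> \<beta> \<gamma> (i, j, l)"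
proof -
  interpret Modules.module "(*) :: 'k poly3 \<Rightarrow> 'k poly3 \<Rightarrow> 'k poly3" by (rule module_mult)
  let ?G = "{monomial a 0 0, monomial 0 b 0, monomial 0 0 c, monomial \<alpha> \<beta> \<gamma>} :: 'k poly3 set"
  have mem: "(monomial i j l :: 'k poly3) \<in> span ?G" if "g \<in> ?G" "g dvd monomial i j l" for g
    using that span_scale[OF span_base] by (metis dvdE mult.commute)
  let ?N = "{p :: 'k poly3. \<forall>e \<in> Poly_Mapping.keys p. in_I a b c \<alpha> \<beta> \<gamma> e}"
  have "subspace ?N"
  proof (rule subspaceI)
    fix p q :: "'k poly3" assume "p \<in> ?N" "q \<in> ?N"
    then show "p + q \<in> ?N" using keys_add[of p q] by blast
  next
    fix r p :: "'k poly3" assume p: "p \<in> ?N"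
    show "r * p \<in> ?N"
    proof safe
      fix i j l assume "(i, j, l) \<in> Poly_Mapping.keys (r * p)"
      then obtain i1 j1 l1 i2 j2 l2 where "(i2, j2, l2) \<in> Poly_Mapping.keys p"
          "i = i1 + i2" "j = j1 + j2" "l = l1 + l2"
        using keys_mult[of r p] by auto
      then show "in_I a b c \<alpha> \<beta> \<gamma> (i, j, l)" using p by (force simp: in_I_def)
    qed
  qed simp
  moreover have "?G \<subseteq> ?N" by (auto simp: monomial_def in_I_def)
  ultimately have "span ?G \<subseteq> ?N" by (rule span_minimal[rotated])
  then have "in_I a b c \<alpha> \<beta> \<gamma> (i, j, l)" if "(monomial i j l :: 'k poly3) \<in> span ?G"
    using that by (auto simp: monomial_def)
  moreover have "(monomial i j l :: 'k poly3) \<in> span ?G" if "in_I a b c \<alpha> \<beta> \<gamma> (i, j, l)"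
    using that mem[of "monomial a 0 0"] mem[of "monomial 0 b 0"] mem[of "monomial 0 0 c"]
      mem[of "monomial \<alpha> \<beta> \<gamma>"] by (auto simp: in_I_def monomial_dvd_iff)
  ultimately show ?thesis unfolding ideal_I_def ideal_gen_def by blast
qed

section \<open>The monomials outside the ideal, in lexicographic order\<close>

definition exponent_monomial :: "nat \<Rightarrow> nat \<times> nat \<Rightarrow> 'k::field poly3" where
  "exponent_monomial d = (\<lambda>(i, j). monomial i j (d - i - j))"

definition exponents_lex :: "nat \<Rightarrow> (nat \<times> nat) list" where
  "exponents_lex d = concat (map (\<lambda>i. map (Pair i) (rev [0..<d - i + 1])) (rev [0..<d + 1]))"

definition exponents_notin :: "nat \<Rightarrow> nat \<Rightarrow> nat \<Rightarrow> nat \<Rightarrow> nat \<Rightarrow> nat \<Rightarrow> nat \<Rightarrow> (nat \<times> nat) list" where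
  "exponents_notin a b c \<alpha> \<beta> \<gamma> d =
     filter (\<lambda>(i, j). \<not> in_I a b c \<alpha> \<beta> \<gamma> (i, j, d - i - j)) (exponents_lex d)"

lemma sorted_concat_Pair:
  fixes xs :: "'a::linorder list" and g :: "'a \<Rightarrow> 'b::linorder list"
  assumes "sorted_wrt (>) xs" and "\<And>x. sorted_wrt (>) (g x)"
  shows "sorted_wrt (>) (concat (map (\<lambda>x. map (Pair x) (g x)) xs))"
  using assms by (induction xs) (auto simp: sorted_wrt_append sorted_wrt_map)

lemma sorted_rev_upt: "sorted_wrt (>) (rev [0..<n])" for n :: nat
  by (simp add: sorted_wrt_rev)

lemma sorted_exponents_notin: "sorted_wrt (>) (exponents_notin a b c \<alpha> \<beta> \<gamma> d)"
  unfolding exponents_notin_def exponents_lex_def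
  by (intro sorted_wrt_filter sorted_concat_Pair sorted_rev_upt)

lemma mem_exponents_notin_iff:
  "(i, j) \<in> set (exponents_notin a b c \<alpha> \<beta> \<gamma> d) \<longleftrightarrow>
     i + j \<le> d \<and> \<not> in_I a b c \<alpha> \<beta> \<gamma> (i, j, d - i - j)"
  by (auto simp: exponents_notin_def exponents_lex_def image_iff simp del: upt_Suc)

lemma monomials_notin_eq:
  "monomials_notin (ideal_I a b c \<alpha> \<beta> \<gamma> :: 'k::field poly3 set) d =
     map (exponent_monomial d) (exponents_notin a b c \<alpha> \<beta> \<gamma> d)"
proof -
  have "(monomials_lex d :: 'k poly3 list) = map (exponent_monomial d) (exponents_lex d)"
    by (simp add: exponent_monomial_def monomials_lex_def exponents_lex_def map_concat o_def)
  then show ?thesis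
    by (simp add: exponent_monomial_def monomials_notin_def exponents_notin_def filter_map o_def case_prod_unfold
        monomial_in_ideal_I_iff)
qed

lemma exponent_monomial_dvd_iff:
  assumes "fst r + snd r \<le> d" "fst r' + snd r' \<le> d + 1"
  shows "(exponent_monomial d r :: 'k::field poly3) dvd exponent_monomial (d + 1) r' \<longleftrightarrow>
    r' \<in> successors r"
  using assms
  by (cases r; cases r') (auto simp: exponent_monomial_def successors_def monomial_dvd_iff)

section \<open>The parity of the weight in each level\<close>

text \<open>
  For \<open>T = S\<close> the two sets partition \<open>S\<close> without \<open>j\<close>; removing evenly many elements below \<open>j\<close> from
  \<open>T\<close> does not change the parity.
\<close>

lemma even_card_greater_plus_card_less:
  fixes S T :: "'a::linorder set"
  assumes "finite S" "T \<subseteq> S" "j \<in> S" "even (card {k \<in> S - T. k < j})"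
  shows "even (card {k \<in> S. j < k} + card {k \<in> T. k < j}) \<longleftrightarrow> odd (card S)"
proof -
  have "S = insert j ({k \<in> S. j < k} \<union> {k \<in> S. k < j})" using assms by auto
  then have "card S = card (insert j ({k \<in> S. j < k} \<union> {k \<in> S. k < j}))" by simp
  also have "\<dots> = Suc (card ({k \<in> S. j < k} \<union> {k \<in> S. k < j}))"
    using assms by (subst card_insert_disjoint) auto
  also have "card ({k \<in> S. j < k} \<union> {k \<in> S. k < j}) = card {k \<in> S. j < k} + card {k \<in> S. k < j}"
    using assms by (intro card_Un_disjoint) auto
  finally have 1: "card S = Suc (card {k \<in> S. j < k} + card {k \<in> S. k < j})" .
  have "{k \<in> S. k < j} = {k \<in> T. k < j} \<union> {k \<in> S - T. k < j}" using assms by auto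
  then have "card {k \<in> S. k < j} = card {k \<in> T. k < j} + card {k \<in> S - T. k < j}"
    using assms by (simp only:) (intro card_Un_disjoint; auto intro: finite_subset)
  with 1 assms show ?thesis by simp
qed

text \<open>
  The rows of level \<open>i\<close> and the columns of level \<open>i + 1\<close> both have \<open>y\<close>- and \<open>z\<close>-exponents of sum
  \<open>s - i\<close> and satisfy the same bounds by \<open>b\<close> and \<open>c\<close>; the bound by \<open>a\<close> holds for both if there is a
  column. Then they can only differ where
  \<open>x\<^sup>\<alpha> y\<^sup>\<beta> z\<^sup>\<gamma>\<close> divides the column but not the row, which forces \<open>i + 1 = \<alpha>\<close>. A column \<open>j\<close> lies
  either before the interval of missing columns or after all of it.
\<close>

lemma even_hole_before:
  fixes a b c \<alpha> \<beta> \<gamma> s :: nat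
  assumes "\<alpha> + \<beta> + \<gamma> \<le> s + 2" "even (s + 2 - \<alpha> - \<beta> - \<gamma>)"
    and "s + 2 \<le> b + \<alpha> + \<gamma>" "s + 2 \<le> c + \<alpha> + \<beta>"
    and R: "R = set (exponents_notin a b c \<alpha> \<beta> \<gamma> s)"
    and C: "C = set (exponents_notin a b c \<alpha> \<beta> \<gamma> (s + 1))"
    and j: "(i + 1, j) \<in> C"
  shows "even (card {k \<in> {k. (i, k) \<in> R} - {k. (i + 1, k) \<in> C}. k < j})"
    and "{k. (i + 1, k) \<in> C} \<subseteq> {k. (i, k) \<in> R}"
proof -
  have mem: "(i + 1, k) \<in> C \<longleftrightarrow> i + k \<le> s \<and> \<not> in_I a b c \<alpha> \<beta> \<gamma> (i + 1, k, s - i - k)" for k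
    by (simp add: C mem_exponents_notin_iff)
  show "{k. (i + 1, k) \<in> C} \<subseteq> {k. (i, k) \<in> R}"
    unfolding mem by (auto simp: R mem_exponents_notin_iff in_I_def)
  have "i + 1 < a" using j unfolding mem by (auto simp: in_I_def)
  show "even (card {k \<in> {k. (i, k) \<in> R} - {k. (i + 1, k) \<in> C}. k < j})"
    (is "even (card ?H)")
  proof (cases "\<alpha> = i + 1 \<and> \<beta> < j")
    case True
    then have "\<not> j + \<gamma> \<le> s - i" using j unfolding mem by (auto simp: in_I_def)
    \<comment> \<open>The two bounds on \<open>s + 2\<close> keep the interval within the rows, below \<open>b\<close> and with \<open>z\<close>-exponents
      below \<open>c\<close>; its length is \<open>s + 2 - \<alpha> - \<beta> - \<gamma>\<close>.\<close>
    then have "?H = {\<beta>..<s + 1 - i - \<gamma>}"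
      unfolding mem using True assms(1,3,4) \<open>i + 1 < a\<close> j[unfolded mem]
      by (auto simp: R mem_exponents_notin_iff in_I_def)
    then show ?thesis using assms(1,2) True by auto
  next
    case False
    then have "?H = {}"
      unfolding mem using \<open>i + 1 < a\<close> by (auto simp: R mem_exponents_notin_iff in_I_def)
    then show ?thesis by (simp only: card.empty dvd_0_right)
  qed
qed

section \<open>Equal signs make permanent and determinant agree\<close>

lemma perm_eq_abs_det:
  fixes A :: "int mat"
  assumes nonneg: "\<And>i j. i < dim_row A \<Longrightarrow> j < dim_col A \<Longrightarrow> 0 \<le> A $$ (i, j)"
    and sign: "\<And>\<pi> \<sigma>. dim_row A = dim_col A \<Longrightarrow>
      \<pi> permutes {0..<dim_row A} \<Longrightarrow> \<sigma> permutes {0..<dim_row A} \<Longrightarrow>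
      (\<forall>i<dim_row A. A $$ (i, \<pi> i) \<noteq> 0) \<Longrightarrow> (\<forall>i<dim_row A. A $$ (i, \<sigma> i) \<noteq> 0) \<Longrightarrow>
      sign \<pi> = sign \<sigma>"
  shows "perm A = \<bar>det A\<bar>"
proof (cases "dim_row A = dim_col A")
  case True
  define n where "n = dim_row A"
  define w where "w \<pi> = (\<Prod>i = 0..<n. A $$ (i, \<pi> i))" for \<pi>
  have perm: "perm A = (\<Sum>\<pi> | \<pi> permutes {0..<n}. w \<pi>)"
    using True by (simp add: perm_def n_def w_def)
  have det: "det A = (\<Sum>\<pi> | \<pi> permutes {0..<n}. sign \<pi> * w \<pi>)"
    using True by (simp add: det_def n_def w_def)
  have w_nonneg: "0 \<le> w \<pi>" if "\<pi> permutes {0..<n}" for \<pi>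
    unfolding w_def using permutes_in_image[OF that] True
    by (intro prod_nonneg ballI nonneg) (auto simp: n_def)
  have w_sign: "sign \<pi> = sign \<sigma>"
    if "\<pi> permutes {0..<n}" "\<sigma> permutes {0..<n}" "w \<pi> \<noteq> 0" "w \<sigma> \<noteq> 0" for \<pi> \<sigma>
    using that True by (intro sign) (auto simp: n_def w_def)
  \<comment> \<open>\<open>\<epsilon>\<close> is the common sign of the nonzero terms, and arbitrary if there are none.\<close>
  obtain \<epsilon> :: int where "\<bar>\<epsilon>\<bar> = 1"
    and \<epsilon>: "\<forall>\<pi>. \<pi> permutes {0..<n} \<longrightarrow> sign \<pi> * w \<pi> = \<epsilon> * w \<pi>"
  proof (cases "\<exists>\<sigma>. \<sigma> permutes {0..<n} \<and> w \<sigma> \<noteq> 0")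
    case True
    then obtain \<sigma> where \<sigma>: "\<sigma> permutes {0..<n}" "w \<sigma> \<noteq> 0" by blast
    show ?thesis
    proof (rule that[of "sign \<sigma>"])
      show "\<forall>\<pi>. \<pi> permutes {0..<n} \<longrightarrow> sign \<pi> * w \<pi> = sign \<sigma> * w \<pi>"
      proof (intro allI impI)
        fix \<pi> assume "\<pi> permutes {0..<n}"
        then show "sign \<pi> * w \<pi> = sign \<sigma> * w \<pi>"
          using w_sign[OF _ \<sigma>(1) _ \<sigma>(2)] by (cases "w \<pi> = 0") auto
      qed
    qed simp
  qed (use that[of 1] in auto)
  have "det A = \<epsilon> * perm A"
    unfolding det perm sum_distrib_left by (rule sum.cong) (simp_all add: \<epsilon>)
  moreover have "0 \<le> perm A"
    unfolding perm by (rule sum_nonneg) (simp add: w_nonneg)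
  ultimately show ?thesis using \<open>\<bar>\<epsilon>\<bar> = 1\<close> by (simp add: abs_mult)
qed (simp add: perm_def det_def)

text \<open>
  The point is that the exponent on the right does not involve \<open>\<pi>\<close>. The factor \<open>Suc (card \<dots>)\<close> has
  the parity of the weight, the size of the level minus \<open>1\<close>.
\<close>

lemma sign_matching:
  fixes a b c \<alpha> \<beta> \<gamma> s :: nat
  assumes hyps: "\<alpha> + \<beta> + \<gamma> \<le> s + 2" "even (s + 2 - \<alpha> - \<beta> - \<gamma>)"
      "s + 2 \<le> b + \<alpha> + \<gamma>" "s + 2 \<le> c + \<alpha> + \<beta>"
    and rs: "rs = exponents_notin a b c \<alpha> \<beta> \<gamma> s"
    and cs: "cs = exponents_notin a b c \<alpha> \<beta> \<gamma> (s + 1)"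
    and len: "length rs = n" "length cs = n"
    and \<pi>: "\<pi> permutes {0..<n}"
    and successors: "\<And>k. k < n \<Longrightarrow> cs ! \<pi> k \<in> successors (rs ! k)"
  shows "sign \<pi> = (-1) ^ (\<Sum>i\<in>fst ` set rs.
     (card {r \<in> set rs. fst r \<le> i} - card {c \<in> set cs. fst c \<le> i}) * Suc (card {k. (i, k) \<in> set rs}))"
proof -
  define f where "f r = cs ! \<pi> (the_inv_into {0..<n} ((!) rs) r)" for r
  have sorted: "sorted_wrt (>) rs" "sorted_wrt (>) cs"
    by (simp_all add: rs cs sorted_exponents_notin)
  have distinct: "distinct xs" if "sorted_wrt (>) xs" for xs :: "(nat \<times> nat) list"
    using that by (induction xs) auto
  from sorted[THEN distinct] have rs_bij: "bij_betw ((!) rs) {0..<n} (set rs)" and cs_bij: "bij_betw ((!) cs) {0..<n} (set cs)"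
    using len by (auto intro!: bij_betw_nth simp: atLeast0LessThan)
  have f: "f (rs ! k) = cs ! \<pi> k" if "k < n" for k
    using rs_bij that by (simp add: f_def bij_betw_def the_inv_into_f_f)
  have "bij_betw ((!) cs \<circ> (\<pi> \<circ> the_inv_into {0..<n} ((!) rs))) (set rs) (set cs)"
    using bij_betw_trans[OF bij_betw_trans[OF bij_betw_the_inv_into[OF rs_bij]
        permutes_imp_bij[OF \<pi>]] cs_bij] .
  then have "bij_betw f (set rs) (set cs)"
    by (simp add: f_def o_def cong: bij_betw_cong)
  then interpret step_matching "set rs" "set cs" f
  proof unfold_locales
    fix r assume "r \<in> set rs"
    then obtain k where "k < n" "rs ! k = r" using len by (auto simp: in_set_conv_nth)
    then show "f r \<in> successors r" using successors f by metis
  qed auto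
  have "even (weight (i, j)) \<longleftrightarrow> even (Suc (card {k. (i, k) \<in> set rs}))"
    if "(i, j) \<in> set rs" "(i + 1, j) \<in> set cs" for i j
  proof -
    have "finite {k. (i, k) \<in> set rs}"
      using finite_vimageI[of "set rs" "Pair i"] by (simp add: vimage_def inj_on_def)
    note hole = even_hole_before[OF hyps arg_cong[OF rs, of set] arg_cong[OF cs, of set] that(2)]
    have "j \<in> {k. (i, k) \<in> set rs}" using that(1) by simp
    from even_card_greater_plus_card_less[OF \<open>finite _\<close> hole(2) this hole(1)]
    show ?thesis by (simp add: weight_def)
  qed
  then have "even (card (inversions f (set rs))) \<longleftrightarrow> even (\<Sum>i\<in>fst ` set rs.
     (card {r \<in> set rs. fst r \<le> i} - card {c \<in> set cs. fst c \<le> i}) * Suc (card {k. (i, k) \<in> set rs}))"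
    by (rule even_inversions_iff_of_weight)
  then show ?thesis
    using sign_eq_inversions_of_matching[OF sorted len \<pi> f] by (simp add: minus_one_power_iff)
qed

theorem corollary5p4:
  fixes a b c \<alpha> \<beta> \<gamma> :: nat and s A B C M :: int
  assumes "\<alpha> < a" and "\<beta> < b" and "\<gamma> < c"
    and "\<not> (\<alpha> = 0 \<and> \<beta> = 0)" and "\<not> (\<alpha> = 0 \<and> \<gamma> = 0)" and "\<not> (\<beta> = 0 \<and> \<gamma> = 0)"
    and "(a + b + c + \<alpha> + \<beta> + \<gamma>) mod 3 = 0"
    and "s = int (a + b + c + \<alpha> + \<beta> + \<gamma>) div 3 - 2"
    and "A = s + 2 - int a"
    and "B = s + 2 - int b"
    and "C = s + 2 - int c"
    and "M = s + 2 - int (\<alpha> + \<beta> + \<gamma>)"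
    and "0 \<le> M"
    and "0 \<le> A" and "A \<le> int (\<beta> + \<gamma>)"
    and "0 \<le> B" and "B \<le> int (\<alpha> + \<gamma>)"
    and "0 \<le> C" and "C \<le> int (\<alpha> + \<beta>)"
    and "even M"
  shows "perm (Z_mat TYPE('k::field) a b c \<alpha> \<beta> \<gamma>) = \<bar>det (Z_mat TYPE('k) a b c \<alpha> \<beta> \<gamma>)\<bar>"
proof -
  define t where "t = (a + b + c + \<alpha> + \<beta> + \<gamma>) div 3 - 2"
  define rs where "rs = exponents_notin a b c \<alpha> \<beta> \<gamma> t"
  define cs where "cs = exponents_notin a b c \<alpha> \<beta> \<gamma> (t + 1)"
  have "(a + b + c + \<alpha> + \<beta> + \<gamma>) div 3 \<ge> 2"
    using assms(1-6) by linarith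
  then have s: "s = int t"
    using assms(8) by (simp add: t_def of_nat_diff zdiv_int)
  have hyps: "\<alpha> + \<beta> + \<gamma> \<le> t + 2" "t + 2 \<le> b + \<alpha> + \<gamma>" "t + 2 \<le> c + \<alpha> + \<beta>"
    using assms(10-13,17,19) unfolding s by linarith+
  have "M = int (t + 2 - (\<alpha> + \<beta> + \<gamma>))"
    using assms(12) hyps(1) unfolding s by (simp add: of_nat_diff)
  then have "even (t + 2 - (\<alpha> + \<beta> + \<gamma>))"
    using assms(20) by (metis even_of_nat)
  then have even: "even (t + 2 - \<alpha> - \<beta> - \<gamma>)"
    by (simp add: diff_diff_left add.assoc)
  have Z: "Z_mat TYPE('k) a b c \<alpha> \<beta> \<gamma> =
      mat (length rs) (length cs) (\<lambda>(k, l). if cs ! l \<in> successors (rs ! k) then 1 else 0)"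
  proof -
    have "(exponent_monomial t (rs ! k) :: 'k poly3) dvd exponent_monomial (t + 1) (cs ! l) \<longleftrightarrow>
        cs ! l \<in> successors (rs ! k)"
      if "k < length rs" "l < length cs" for k l
    proof (rule exponent_monomial_dvd_iff)
      show "fst (rs ! k) + snd (rs ! k) \<le> t" "fst (cs ! l) + snd (cs ! l) \<le> t + 1"
        using that by (metis nth_mem rs_def cs_def mem_exponents_notin_iff prod.collapse)+
    qed
    then show ?thesis
      unfolding Z_mat_def Let_def t_def[symmetric] monomials_notin_eq rs_def[symmetric] cs_def[symmetric]
      by (intro eq_matI) auto
  qed
  show ?thesis
  proof (rule perm_eq_abs_det)
    fix \<pi> \<sigma>
    let ?Z = "Z_mat TYPE('k) a b c \<alpha> \<beta> \<gamma>"
    assume sq: "dim_row ?Z = dim_col ?Z"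
    then have len: "length cs = length rs" by (simp add: Z)
    assume \<pi>: "\<pi> permutes {0..<dim_row ?Z}" "\<forall>k<dim_row ?Z. ?Z $$ (k, \<pi> k) \<noteq> 0"
      and \<sigma>: "\<sigma> permutes {0..<dim_row ?Z}" "\<forall>k<dim_row ?Z. ?Z $$ (k, \<sigma> k) \<noteq> 0"
    have step: "cs ! \<tau> k \<in> successors (rs ! k)"
      if "\<tau> permutes {0..<dim_row ?Z}" "\<forall>k<dim_row ?Z. ?Z $$ (k, \<tau> k) \<noteq> 0"
        "k < length rs" for \<tau> k
    proof -
      have "\<tau> k < length cs" using permutes_in_image[OF that(1), of k] that(3) len by (simp add: Z)
      then show ?thesis using that(2,3) by (auto simp: Z split: if_splits)
    qed
    show "sign \<pi> = sign \<sigma>"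
      using sign_matching[OF hyps(1) even hyps(2,3) rs_def cs_def refl len, of \<pi>]
        sign_matching[OF hyps(1) even hyps(2,3) rs_def cs_def refl len, of \<sigma>]
        step[OF \<pi>] step[OF \<sigma>] \<pi>(1) \<sigma>(1) by (simp add: Z)
  qed (auto simp: Z)
qed

end
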